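(* Let $[l,u]\subset\mathbb{R}$ be an interval and let $p:\mathbb{R}\to\mathbb{R}$, $p(x)=m\,x+d$, be a linear approximation of $\phi\in\{\mathrm{ReLU},\tanh,\sigma\}$ within $[l,u]$. The approximation errors $$\underline{e}:=\min_{x\in[l,u]}\big(\phi(x)-p(x)\big),\qquad \overline{e}:=\max_{x\in[l,u]}\big(\phi(x)-p(x)\big)$$ of $p$ for $\phi$ are computed as $$\underline{e}=\min_{x\in\mathcal{P}_\phi\cap[l,u]}\big(\phi(x)-p(x)\big),\qquad \overline{e}=\max_{x\in\mathcal{P}_\phi\cap[l,u]}\big(\phi(x)-p(x)\big),$$ where $$\mathcal{P}_{\mathrm{ReLU}}=\{0,l,u\},\quad \mathcal{P}_{\tanh}=\big\{\pm\tanh^{-1}(\sqrt{1-m}),\,l,\,u\big\},\quad \mathcal{P}_{\sigma}=\big\{\pm 2\tanh^{-1}(\sqrt{1-4m}),\,l,\,u\big\}.$$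
   Context: $\mathrm{ReLU}(x)=\max(0,x)$ is the rectified linear unit, $\tanh$ is the hyperbolic tangent, $\sigma(x)=1/(1+e^{-x})$ is the logistic sigmoid, and $\tanh^{-1}$ is the inverse hyperbolic tangent. *)

theory Defs
  imports Complex_Main
begin

datatype activation = ReLU | Tanh | Sigmoid

fun act :: "activation \<Rightarrow> real \<Rightarrow> real" where
  "act ReLU x = max 0 x"
| "act Tanh x = tanh x"
| "act Sigmoid x = 1 / (1 + exp (- x))"

text \<open>
  The minimum and maximum of a real function over a possibly infinite set. \<^const>\<open>Min\<close> and
  \<^const>\<open>Max\<close> are only meaningful for finite sets; infima and suprema need not be attained.
  The values are unspecified if there is no least (greatest) value.
\<close>

definition min_on :: "real set \<Rightarrow> (real \<Rightarrow> real) \<Rightarrow> real" where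
  "min_on S f = (LEAST y. y \<in> f ` S)"

definition max_on :: "real set \<Rightarrow> (real \<Rightarrow> real) \<Rightarrow> real" where
  "max_on S f = (GREATEST y. y \<in> f ` S)"

definition lower_error :: "(real \<Rightarrow> real) \<Rightarrow> (real \<Rightarrow> real) \<Rightarrow> real \<Rightarrow> real \<Rightarrow> real" where
  "lower_error \<phi> p l u = min_on {l..u} (\<lambda>x. \<phi> x - p x)"

definition upper_error :: "(real \<Rightarrow> real) \<Rightarrow> (real \<Rightarrow> real) \<Rightarrow> real \<Rightarrow> real \<Rightarrow> real" where
  "upper_error \<phi> p l u = max_on {l..u} (\<lambda>x. \<phi> x - p x)"

text \<open>
  The points \<open>\<plusminus> artanh (sqrt (1 - m))\<close> exist as real numbers only if the radicand is nonnegative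
  and its root lies in the domain \<open>(-1, 1)\<close> of \<^const>\<open>artanh\<close>. As \<^const>\<open>sqrt\<close> and
  \<^const>\<open>artanh\<close> are total in HOL, this is made explicit: where the expressions are undefined,
  only the endpoints remain. Likewise for \<open>\<plusminus> 2 artanh (sqrt (1 - 4 m))\<close>.
\<close>

fun crit_points :: "activation \<Rightarrow> real \<Rightarrow> real \<Rightarrow> real \<Rightarrow> real set" where
  "crit_points ReLU m l u = {0, l, u}"
| "crit_points Tanh m l u =
     (if 0 \<le> 1 - m \<and> sqrt (1 - m) < 1
      then {artanh (sqrt (1 - m)), - artanh (sqrt (1 - m))} else {}) \<union> {l, u}"
| "crit_points Sigmoid m l u =
     (if 0 \<le> 1 - 4 * m \<and> sqrt (1 - 4 * m) < 1
      then {2 * artanh (sqrt (1 - 4 * m)), - 2 * artanh (sqrt (1 - 4 * m))} else {}) \<union> {l, u}"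

end

theory Submission
  imports Defs
begin

text \<open>Write \<open>f\<close> for the error, activation minus affine map. For tanh and the
  sigmoid, \<open>f\<close> is differentiable, so on a compact interval its extrema are attained at
  endpoints or at interior points where the activation has slope \<open>m\<close>. Since tanh' = 1 -
  tanh^2, slope \<open>m\<close> means tanh^2 = 1 - m, which pins down x up to sign; the sigmoid is
  a rescaled tanh, which accounts for the factors 2 and 4 in its points. ReLU has a kink at 0, but
  there \<open>f\<close> is affine on each side of 0, so its extrema lie at 0 or at endpoints. In
  each case every value of \<open>f\<close> lies between two values at candidate points
  (\<open>act_error_bounds\<close>), and \<open>extrema_eq_Min_Max\<close> turns this into equality
  of extrema. Candidates that are not extremal do no harm: they lie in the interval too.\<close>

text \<open>Reduces the extrema over an infinite set to pointwise domination by a finite subset.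
  Attainment is part of the conclusion because \<open>min_on\<close> and \<open>max_on\<close> are
  unspecified without it.\<close>

lemma extrema_eq_Min_Max:
  fixes f :: "real \<Rightarrow> real"
  assumes "finite P" "P \<subseteq> S" "S \<noteq> {}"
    and lower: "\<And>y. y \<in> S \<Longrightarrow> \<exists>x\<in>P. f x \<le> f y"
    and upper: "\<And>y. y \<in> S \<Longrightarrow> \<exists>x\<in>P. f y \<le> f x"
  shows "(\<exists>x\<in>S. \<forall>y\<in>S. f x \<le> f y) \<and> (\<exists>x\<in>S. \<forall>y\<in>S. f y \<le> f x) \<and>
         min_on S f = Min (f ` P) \<and> max_on S f = Max (f ` P)"
proof -
  have fin: "finite (f ` P)" and ne: "f ` P \<noteq> {}"
    using assms by auto
  obtain a where a: "a \<in> P" "f a = Min (f ` P)"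
    using Min_in[OF fin ne] by (metis imageE)
  obtain b where b: "b \<in> P" "f b = Max (f ` P)"
    using Max_in[OF fin ne] by (metis imageE)
  have a_min: "f a \<le> f y" if "y \<in> S" for y
    using lower[OF that] Min_le[OF fin] a by fastforce
  have b_max: "f y \<le> f b" if "y \<in> S" for y
    using upper[OF that] Max_ge[OF fin] b by fastforce
  have S: "a \<in> S" "b \<in> S"
    using a b assms(2) by auto
  have "min_on S f = f a"
    unfolding min_on_def using S(1) a_min by (intro Least_equality) blast+
  moreover have "max_on S f = f b"
    unfolding max_on_def using S(2) b_max by (intro Greatest_equality) blast+
  moreover have "\<exists>x\<in>S. \<forall>y\<in>S. f x \<le> f y" "\<exists>x\<in>S. \<forall>y\<in>S. f y \<le> f x"
    using S a_min b_max by blast+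
  ultimately show ?thesis
    using a(2) b(2) by simp
qed

text \<open>Extreme value theorem plus Fermat: a global minimiser exists, and if interior it is
  stationary, so it belongs to \<open>P\<close> either way.\<close>

lemma lower_bound_at_critical_point:
  fixes f :: "real \<Rightarrow> real"
  assumes deriv: "\<And>x. (f has_real_derivative f' x) (at x)"
    and crit: "\<And>x. l < x \<Longrightarrow> x < u \<Longrightarrow> f' x = 0 \<Longrightarrow> x \<in> P"
    and "l \<in> P" "u \<in> P" "y \<in> {l..u}"
  shows "\<exists>x\<in>P \<inter> {l..u}. f x \<le> f y"
proof -
  have "continuous_on {l..u} f"
    using deriv by (meson DERIV_isCont continuous_at_imp_continuous_on)
  then obtain x where x: "x \<in> {l..u}" "\<forall>z\<in>{l..u}. f x \<le> f z"
    using continuous_attains_inf[of "{l..u}" f] assms(5) by auto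
  have "x \<in> P"
  proof (cases "x = l \<or> x = u")
    case False
    then have "l < x" "x < u" using x by auto
    moreover have "f' x = 0"
    proof (rule DERIV_local_min[OF deriv])
      \<comment> \<open>This radius keeps the neighbourhood of \<open>x\<close> inside the interval,
        where \<open>x\<close> is minimal.\<close>
      show "0 < min (x - l) (u - x)" using \<open>l < x\<close> \<open>x < u\<close> by simp
      show "\<forall>z. \<bar>x - z\<bar> < min (x - l) (u - x) \<longrightarrow> f x \<le> f z"
        using x(2) by (auto simp: abs_if split: if_splits)
    qed
    ultimately show ?thesis by (rule crit)
  qed (use assms in auto)
  then show ?thesis using x assms(5) by (intro bexI[of _ x]) auto
qed

lemma upper_bound_at_critical_point:
  fixes f :: "real \<Rightarrow> real"
  assumes deriv: "\<And>x. (f has_real_derivative f' x) (at x)"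
    and crit: "\<And>x. l < x \<Longrightarrow> x < u \<Longrightarrow> f' x = 0 \<Longrightarrow> x \<in> P"
    and "l \<in> P" "u \<in> P" "y \<in> {l..u}"
  shows "\<exists>x\<in>P \<inter> {l..u}. f y \<le> f x"
proof -
  \<comment> \<open>Negation swaps maxima and minima and preserves stationary points.\<close>
  have "\<exists>x\<in>P \<inter> {l..u}. - f x \<le> - f y"
    by (rule lower_bound_at_critical_point[where f' = "\<lambda>x. - f' x"])
       (use assms in \<open>auto intro!: DERIV_minus\<close>)
  then show ?thesis by simp
qed

lemma affine_bounds_on_interval:
  fixes c d :: real
  assumes "y \<in> {a..b}"
  shows "\<exists>x\<in>{a, b}. c * x + d \<le> c * y + d" and "\<exists>x\<in>{a, b}. c * y + d \<le> c * x + d"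
proof -
  have "c * a \<le> c * y \<and> c * y \<le> c * b \<or> c * b \<le> c * y \<and> c * y \<le> c * a"
    using assms by (cases "c \<ge> 0") (simp_all add: mult_left_mono mult_left_mono_neg)
  then show "\<exists>x\<in>{a, b}. c * x + d \<le> c * y + d" "\<exists>x\<in>{a, b}. c * y + d \<le> c * x + d"
    by auto
qed

lemma relu_error_bounds:
  fixes l u m d y :: real
  defines "f \<equiv> \<lambda>x. max 0 x - (m * x + d)"
  assumes y: "y \<in> {l..u}"
  shows "\<exists>x\<in>{0, l, u} \<inter> {l..u}. f x \<le> f y" and "\<exists>x\<in>{0, l, u} \<inter> {l..u}. f y \<le> f x"
proof -
  \<comment> \<open>Cut the interval at the kink and keep the piece containing \<open>y\<close>: the
    slope is \<open>1 - m\<close> to the right of 0 and \<open>- m\<close> to the left. The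
    \<open>max\<close> and \<open>min\<close> with 0 cover intervals that do not contain 0.\<close>
  have "\<exists>a b c. {a, b} \<subseteq> {0, l, u} \<inter> {l..u} \<and> y \<in> {a..b} \<and> (\<forall>x\<in>{a..b}. f x = c * x + - d)"
  proof (cases "y \<ge> 0")
    case True
    then show ?thesis using y
      by (intro exI[of _ "max 0 l"] exI[of _ u] exI[of _ "1 - m"])
         (auto simp: f_def algebra_simps max_def)
  next
    case False
    then show ?thesis using y
      by (intro exI[of _ l] exI[of _ "min 0 u"] exI[of _ "- m"])
         (auto simp: f_def algebra_simps max_def min_def)
  qed
  then obtain a b c where ab: "{a, b} \<subseteq> {0, l, u} \<inter> {l..u}" "y \<in> {a..b}"
    and f: "\<And>x. x \<in> {a..b} \<Longrightarrow> f x = c * x + - d"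
    by blast
  have "\<exists>x\<in>{a, b}. f x \<le> f y" "\<exists>x\<in>{a, b}. f y \<le> f x"
    using affine_bounds_on_interval[OF ab(2), of c "- d"] ab(2) f[of a] f[of b] f[of y] by auto
  then show "\<exists>x\<in>{0, l, u} \<inter> {l..u}. f x \<le> f y" "\<exists>x\<in>{0, l, u} \<inter> {l..u}. f y \<le> f x"
    using ab(1) by blast+
qed

text \<open>As tanh is odd and increasing, \<open>sqrt c\<close> is tanh of the absolute value of
  \<open>x\<close>, which \<open>artanh\<close> inverts. The first two conclusions are the guards in
  \<open>crit_points\<close>: they hold whenever a stationary point exists.\<close>

lemma tanh_sq_eq_imp_artanh:
  fixes x c :: real
  assumes "tanh x ^ 2 = c"
  shows "0 \<le> c" "sqrt c < 1" "x = artanh (sqrt c) \<or> x = - artanh (sqrt c)"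
proof -
  have sqrt_c: "sqrt c = tanh \<bar>x\<bar>"
    using assms tanh_real_abs[of x] by (metis real_sqrt_abs)
  show "0 \<le> c" using assms by auto
  show "sqrt c < 1" unfolding sqrt_c by (rule tanh_real_lt_1)
  have "artanh (sqrt c) = \<bar>x\<bar>"
    unfolding sqrt_c by (rule artanh_tanh_real)
  then show "x = artanh (sqrt c) \<or> x = - artanh (sqrt c)" by linarith
qed

text \<open>Lets the sigmoid inherit its derivative and stationary points from tanh.\<close>

lemma sigmoid_eq_tanh:
  fixes x :: real
  shows "1 / (1 + exp (- x)) = (1 + tanh (x / 2)) / 2"
proof -
  have "1 + exp (- x) > 0" by (simp add: add_pos_pos)
  then show ?thesis
    by (simp add: tanh_real_altdef field_simps)
qed

lemma smooth_act_has_derivative: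
  fixes x :: real
  shows "(act Tanh has_real_derivative 1 - tanh x ^ 2) (at x)"
    and "(act Sigmoid has_real_derivative (1 - tanh (x / 2) ^ 2) / 4) (at x)"
proof -
  have "act Tanh = tanh" "act Sigmoid = (\<lambda>x. (1 + tanh (x / 2)) / 2)"
    by (auto simp: sigmoid_eq_tanh)
  then show "(act Tanh has_real_derivative 1 - tanh x ^ 2) (at x)"
    and "(act Sigmoid has_real_derivative (1 - tanh (x / 2) ^ 2) / 4) (at x)"
    by (auto intro!: derivative_eq_intros)
qed

lemma critical_points_tanh:
  assumes "1 - tanh x ^ 2 = (m::real)"
  shows "x \<in> crit_points Tanh m l u"
  using tanh_sq_eq_imp_artanh[of x "1 - m"] assms by auto

lemma critical_points_sigmoid:
  assumes "(1 - tanh (x / 2) ^ 2) / 4 = (m::real)"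
  shows "x \<in> crit_points Sigmoid m l u"
proof -
  have "tanh (x / 2) ^ 2 = 1 - 4 * m" using assms by simp
  note artanh = tanh_sq_eq_imp_artanh[OF this]
  have "x = 2 * artanh (sqrt (1 - 4 * m)) \<or> x = - 2 * artanh (sqrt (1 - 4 * m))"
    using artanh(3) by linarith
  then show ?thesis
    unfolding crit_points.simps using artanh(1,2) by (simp only: if_True simp_thms) blast
qed

lemma act_error_bounds:
  fixes l u m d y :: real
  defines "f \<equiv> \<lambda>a x. act a x - (m * x + d)"
  assumes y: "y \<in> {l..u}"
  shows "(\<exists>x\<in>crit_points a m l u \<inter> {l..u}. f a x \<le> f a y) \<and>
         (\<exists>x\<in>crit_points a m l u \<inter> {l..u}. f a y \<le> f a x)"
proof -
  \<comment> \<open>The argument common to tanh and the sigmoid: it suffices that the candidates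
    include all points where the derivative \<open>D\<close> equals the slope
    \<open>m\<close>.\<close>
  have smooth: ?thesis
    if D: "\<And>x. (act a has_real_derivative D x) (at x)"
      and D_eq: "\<And>x. D x = m \<Longrightarrow> x \<in> crit_points a m l u" for D
  proof -
    have deriv: "(f a has_real_derivative D x - m) (at x)" for x
      unfolding f_def by (auto intro!: derivative_eq_intros D)
    have crit: "x \<in> crit_points a m l u" if "D x - m = 0" for x
      using that by (intro D_eq) simp
    have ends: "l \<in> crit_points a m l u" "u \<in> crit_points a m l u"
      by (cases a; simp)+
    show ?thesis
      using lower_bound_at_critical_point[OF deriv crit ends y]
        upper_bound_at_critical_point[OF deriv crit ends y] by blast
  qed
  show ?thesis
  proof (cases a)
    case ReLU
    then show ?thesis using relu_error_bounds[OF y, of m d] by (simp add: f_def)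
  next
    case Tanh
    show ?thesis
      unfolding Tanh
      by (rule smooth[unfolded Tanh])
         (rule smooth_act_has_derivative critical_points_tanh, assumption?)+
  next
    case Sigmoid
    show ?thesis
      unfolding Sigmoid
      by (rule smooth[unfolded Sigmoid])
         (rule smooth_act_has_derivative critical_points_sigmoid, assumption?)+
  qed
qed

text \<open>The two attainment conjuncts certify that both errors are genuine extrema rather than
  unspecified values; \<open>l \<le> u\<close> makes the interval nonempty.\<close>

theorem proposition10:
  fixes a :: activation and p :: "real \<Rightarrow> real" and l u m d :: real
  assumes "l \<le> u"
    and "p = (\<lambda>x. m * x + d)"
  shows "(\<exists>x\<in>{l..u}. \<forall>y\<in>{l..u}. act a x - p x \<le> act a y - p y) \<and>
         (\<exists>x\<in>{l..u}. \<forall>y\<in>{l..u}. act a y - p y \<le> act a x - p x) \<and>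
         lower_error (act a) p l u = Min ((\<lambda>x. act a x - p x) ` (crit_points a m l u \<inter> {l..u})) \<and>
         upper_error (act a) p l u = Max ((\<lambda>x. act a x - p x) ` (crit_points a m l u \<inter> {l..u}))"
  unfolding lower_error_def upper_error_def assms(2)
proof (rule extrema_eq_Min_Max)
  show "finite (crit_points a m l u \<inter> {l..u})" by (cases a) auto
  show "{l..u} \<noteq> {}" using assms by simp
qed (simp_all only: act_error_bounds Int_lower2)

end
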